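(* Let $d$ be a nonnegative integer and let $A\in \mathrm{Mat}_{d+1}(\mathbb{R})$ be a nonnegative matrix (every entry is nonnegative). Then for all $0\le s,t\le d$ the following are equivalent. (i) The matrix $A$ is diagonalizable (over $\mathbb{R}$), and $\partial(s,t)=d$ in the directed graph $\Gamma(A)$. (ii) The matrix $A$ is multiplicity-free. Moreover, with $\{\theta_i\}_{i=0}^d$ an ordering of the eigenvalues of $A$ and $E_i$ the primitive idempotent of $A$ associated with $\theta_i$, the $(s,t)$-entry of $E_i$ times $$(\theta_i-\theta_0)\cdots(\theta_i-\theta_{i-1})(\theta_i-\theta_{i+1})\cdots(\theta_i-\theta_d)$$ is independent of $i$ for $0\le i\le d$, and this common value is nonzero.
   Context: $\mathrm{Mat}_{d+1}(\mathbb{R})$ is the algebra of $(d+1)\times(d+1)$ real matrices, with rows and columns indexed by $0,1,\ldots,d$; it acts on $V=\mathbb{R}^{d+1}$ by left multiplication. $\Gamma(A)$ is the directed graph with vertex set $\{0,1,\ldots,d\}$, where $i\rightarrow j$ whenever $i\ne j$ and $A_{ij}\neq 0$. The directed distance $\partial$ is defined by: $\partial(s,t)=i$ whenever there exists a directed path from $s$ to $t$ of length $i$ and there is no directed path from $s$ to $t$ of length less than $i$. $A$ is multiplicity-free whenever $A$ is diagonalizable over $\mathbb{R}$ and all its eigenspaces have dimension $1$. In this case let $\{\theta_i\}_{i=0}^d$ be an ordering of the eigenvalues of $A$ and let $V_i$ be the eigenspace for $\theta_i$; the primitive idempotent $E_i\in\mathrm{Mat}_{d+1}(\mathbb{R})$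 of $A$ associated with $\theta_i$ is defined by $(E_i-I)V_i=0$ and $E_iV_j=0$ for $j\neq i$. Empty products equal $1$. *)

theory Defs
  imports
    "Jordan_Normal_Form.Spectral_Radius"
    "Jordan_Normal_Form.Matrix_Kernel"
    "Graph_Theory.Pair_Digraph"
begin

definition diagonalizable :: "'a :: field mat \<Rightarrow> bool" where
  "diagonalizable A \<longleftrightarrow> (\<exists>D. diagonal_mat D \<and> similar_mat A D)"

(* char_matrix A \<theta> is the matrix A - \<theta> I. *)
definition eigenspace :: "'a :: field mat \<Rightarrow> 'a \<Rightarrow> 'a vec set" where
  "eigenspace A \<theta> = mat_kernel (char_matrix A \<theta>)"

(* kernel_dim M is the dimension of the vector space mat_kernel M. *)
definition multiplicity_free :: "'a :: field mat \<Rightarrow> bool" where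
  "multiplicity_free A \<longleftrightarrow>
     diagonalizable A \<and> (\<forall>\<theta>. eigenvalue A \<theta> \<longrightarrow> kernel_dim (char_matrix A \<theta>) = 1)"

(* A listing of all eigenvalues of A, without repetition, as \<theta> 0, ..., \<theta> d. *)
definition eigenvalue_ordering :: "'a :: field mat \<Rightarrow> nat \<Rightarrow> (nat \<Rightarrow> 'a) \<Rightarrow> bool" where
  "eigenvalue_ordering A d \<theta> \<longleftrightarrow> bij_betw \<theta> {0..d} (spectrum A)"

(* If A is diagonalizable, its eigenspaces span the whole space as a direct sum, so there is
   exactly one such E for each eigenvalue \<theta>. *)
definition primitive_idempotent :: "'a :: field mat \<Rightarrow> 'a \<Rightarrow> 'a mat \<Rightarrow> bool" where
  "primitive_idempotent A \<theta> E \<longleftrightarrow>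
     E \<in> carrier_mat (dim_row A) (dim_row A) \<and>
     (\<forall>v \<in> eigenspace A \<theta>. (E - 1\<^sub>m (dim_row A)) *\<^sub>v v = 0\<^sub>v (dim_row A)) \<and>
     (\<forall>\<mu> \<in> spectrum A. \<mu> \<noteq> \<theta> \<longrightarrow> (\<forall>v \<in> eigenspace A \<mu>. E *\<^sub>v v = 0\<^sub>v (dim_row A)))"

definition matrix_digraph :: "'a :: zero mat \<Rightarrow> nat pair_pre_digraph" where
  "matrix_digraph A =
     \<lparr> pverts = {0..<dim_row A},
       parcs = {(i, j). i < dim_row A \<and> j < dim_row A \<and> i \<noteq> j \<and> A $$ (i, j) \<noteq> 0} \<rparr>"

(* directed_distance G s t k says that the distance from s to t exists and equals k; no k
   satisfies this if t is not reachable from s. Paths are arc walks: allowing repeated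
   vertices does not change the least length. *)
definition directed_distance :: "('v, 'e) pre_digraph \<Rightarrow> 'v \<Rightarrow> 'v \<Rightarrow> nat \<Rightarrow> bool" where
  "directed_distance G s t k \<longleftrightarrow>
     (\<exists>p. pre_digraph.awalk G s p t \<and> length p = k) \<and>
     \<not> (\<exists>p. pre_digraph.awalk G s p t \<and> length p < k)"

end

theory Submission
  imports Defs "Jordan_Normal_Form.Jordan_Normal_Form_Uniqueness"
begin

text \<open>
  For nonnegative A the distance from s to t is d iff the (s,t)-entry of the k-th power of A
  vanishes for k < d and not for k = d. If A is diagonalizable with primitive idempotents E x, for
  x in the spectrum S, this entry is the k-th moment of the weights (E x)(s,t) on S. Since S has at
  most d + 1 points, Lagrange interpolation shows that the first d moments vanish and the d-th does
  not iff S has exactly d + 1 points and each weight is the same nonzero multiple of the inverse of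
  the product of x - y over the other points y of S.
\<close>

section \<open>Walks and powers of nonnegative matrices\<close>

lemma wf_matrix_digraph: "wf_digraph (with_proj (matrix_digraph A))"
  by unfold_locales (auto simp: matrix_digraph_def)

lemma nonneg_pow_mat:
  fixes A :: "real mat"
  assumes A: "A \<in> carrier_mat n n" and nonneg: "\<And>i j. i < n \<Longrightarrow> j < n \<Longrightarrow> A $$ (i, j) \<ge> 0"
    and "i < n" "j < n"
  shows "(A ^\<^sub>m k) $$ (i, j) \<ge> 0"
  using assms(3,4)
proof (induction k arbitrary: j)
  case 0
  then show ?case using A by simp
next
  case (Suc k)
  have "A ^\<^sub>m k \<in> carrier_mat n n" using A by simp
  then show ?case using A Suc nonneg
    by (auto simp: scalar_prod_def intro!: sum_nonneg mult_nonneg_nonneg)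
qed

text \<open>Nonnegative terms cannot cancel: the sum defining an entry of the product is positive as
  soon as one summand is nonzero, and then both factors of that summand are positive.\<close>

lemma pow_mat_pos_Suc:
  fixes A :: "real mat"
  assumes A: "A \<in> carrier_mat n n" and nonneg: "\<And>i j. i < n \<Longrightarrow> j < n \<Longrightarrow> A $$ (i, j) \<ge> 0"
    and ij: "i < n" "j < n"
  shows "(A ^\<^sub>m Suc k) $$ (i, j) > 0 \<longleftrightarrow>
    (\<exists>u<n. (A ^\<^sub>m k) $$ (i, u) > 0 \<and> A $$ (u, j) > 0)"
proof -
  have B: "A ^\<^sub>m k \<in> carrier_mat n n" using A by simp
  have eq: "(A ^\<^sub>m Suc k) $$ (i, j) = (\<Sum>u = 0..<n. (A ^\<^sub>m k) $$ (i, u) * A $$ (u, j))"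
    using A B ij by (simp add: scalar_prod_def)
  have nn: "(A ^\<^sub>m k) $$ (i, u) \<ge> 0" "A $$ (u, j) \<ge> 0" if "u < n" for u
    using nonneg_pow_mat[OF A nonneg] nonneg that ij by auto
  have "(A ^\<^sub>m Suc k) $$ (i, j) > 0 \<longleftrightarrow>
      (\<exists>u\<in>{0..<n}. (A ^\<^sub>m k) $$ (i, u) * A $$ (u, j) \<noteq> 0)"
    unfolding eq using nn
    by (subst less_le, subst eq_commute, subst sum_nonneg_eq_0_iff) (auto intro: sum_nonneg)
  also have "\<dots> \<longleftrightarrow> (\<exists>u<n. (A ^\<^sub>m k) $$ (i, u) > 0 \<and> A $$ (u, j) > 0)"
    using nn by (metis atLeastLessThan_iff less_le mult_eq_0_iff zero_le)
  finally show ?thesis .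
qed

text \<open>Each further power multiplies by \<open>A\<close> on the right, so the induction removes
  the last arc of the walk.\<close>

lemma awalk_imp_pow_mat_pos:
  fixes A :: "real mat"
  assumes A: "A \<in> carrier_mat n n" and nonneg: "\<And>i j. i < n \<Longrightarrow> j < n \<Longrightarrow> A $$ (i, j) \<ge> 0"
    and "pre_digraph.awalk (with_proj (matrix_digraph A)) s p t"
  shows "(A ^\<^sub>m length p) $$ (s, t) > 0"
  using assms(3)
proof (induction p arbitrary: t rule: rev_induct)
  case Nil
  interpret wf_digraph "with_proj (matrix_digraph A)" by (rule wf_matrix_digraph)
  show ?case using Nil[unfolded awalk_Nil_iff] A by (auto simp: matrix_digraph_def)
next
  case (snoc e p)
  interpret wf_digraph "with_proj (matrix_digraph A)" by (rule wf_matrix_digraph)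
  define u where "u = awlast s p"
  have walk: "awalk s p u" and "awalk u [e] t"
    using snoc.prems by (auto simp: u_def)
  then have "(u, t) \<in> parcs (matrix_digraph A)"
    by (auto simp: awalk_Cons_iff awalk_Nil_iff)
  then have e: "u < n" "t < n" "A $$ (u, t) \<noteq> 0"
    using A by (auto simp: matrix_digraph_def)
  moreover have "s < n" using awalk_hd_in_verts[OF walk] A by (simp add: matrix_digraph_def)
  moreover have "A $$ (u, t) > 0" using nonneg[OF e(1,2)] e(3) by simp
  ultimately show ?case
    using snoc.IH[OF walk] pow_mat_pos_Suc[OF A nonneg] by auto
qed

text \<open>Diagonal entries contribute to the power but not to the digraph: omitting them shortens the walk.\<close>

lemma pow_mat_pos_imp_awalk:
  fixes A :: "real mat"
  assumes A: "A \<in> carrier_mat n n" and nonneg: "\<And>i j. i < n \<Longrightarrow> j < n \<Longrightarrow> A $$ (i, j) \<ge> 0"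
    and "s < n" "t < n" "(A ^\<^sub>m k) $$ (s, t) > 0"
  shows "\<exists>p. pre_digraph.awalk (with_proj (matrix_digraph A)) s p t \<and> length p \<le> k"
  using assms(4,5)
proof (induction k arbitrary: t)
  case 0
  interpret wf_digraph "with_proj (matrix_digraph A)" by (rule wf_matrix_digraph)
  have "s = t" using 0 A \<open>s < n\<close> by (auto split: if_splits)
  then have "awalk s [] t"
    unfolding awalk_Nil_iff using A \<open>s < n\<close> by (simp add: matrix_digraph_def)
  then show ?case by auto
next
  case (Suc k)
  interpret wf_digraph "with_proj (matrix_digraph A)" by (rule wf_matrix_digraph)
  obtain u where u: "u < n" "(A ^\<^sub>m k) $$ (s, u) > 0" "A $$ (u, t) > 0"
    using Suc.prems pow_mat_pos_Suc[OF A nonneg \<open>s < n\<close>] by blast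
  then obtain p where p: "awalk s p u" "length p \<le> k" using Suc.IH by blast
  show ?case
  proof (cases "u = t")
    case True
    then show ?thesis using p by auto
  next
    case False
    then have "(u, t) \<in> parcs (matrix_digraph A)" "t \<in> pverts (matrix_digraph A)"
      using u Suc.prems(1) A by (auto simp: matrix_digraph_def)
    then have "awalk u [(u, t)] t" by (simp add: awalk_Cons_iff awalk_Nil_iff)
    then have "awalk s (p @ [(u, t)]) t" using p awalk_appendI by blast
    then show ?thesis using p by (intro exI[of _ "p @ [(u, t)]"]) auto
  qed
qed

text \<open>A positive entry of the k-th power yields only a walk of length at most k, whereas a
  walk gives a positive entry at exactly its length. For the least length this asymmetry does no
  harm.\<close>

lemma directed_distance_iff_pow_mat:
  fixes A :: "real mat"
  assumes A: "A \<in> carrier_mat n n" and nonneg: "\<And>i j. i < n \<Longrightarrow> j < n \<Longrightarrow> A $$ (i, j) \<ge> 0"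
    and st: "s < n" "t < n"
  shows "directed_distance (with_proj (matrix_digraph A)) s t d \<longleftrightarrow>
    (\<forall>k<d. (A ^\<^sub>m k) $$ (s, t) = 0) \<and> (A ^\<^sub>m d) $$ (s, t) \<noteq> 0"
proof -
  let ?walk = "\<lambda>p. pre_digraph.awalk (with_proj (matrix_digraph A)) s p t"
  have pos: "(A ^\<^sub>m k) $$ (s, t) \<noteq> 0 \<longleftrightarrow> (A ^\<^sub>m k) $$ (s, t) > 0" for k
    using nonneg_pow_mat[OF A nonneg st, of k] by auto
  have to_pow: "(A ^\<^sub>m length p) $$ (s, t) > 0" if "?walk p" for p
    using awalk_imp_pow_mat_pos[OF A nonneg that] .
  have to_walk: "\<exists>p. ?walk p \<and> length p \<le> k" if "(A ^\<^sub>m k) $$ (s, t) > 0" for k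
    using pow_mat_pos_imp_awalk[OF A nonneg st that] .
  have short: "(\<exists>p. ?walk p \<and> length p < d) \<longleftrightarrow> (\<exists>k<d. (A ^\<^sub>m k) $$ (s, t) \<noteq> 0)"
    unfolding pos using to_pow to_walk by (meson le_less_trans)
  \<comment> \<open>A walk obtained from the d-th power has length at most d; if none is shorter
    than d, its length is d.\<close>
  show ?thesis
    unfolding directed_distance_def short
    using pos to_pow to_walk short by (metis le_neq_implies_less)
qed

section \<open>Lagrange interpolation\<close>

text \<open>The right-hand side is the top coefficient of the Lagrange interpolant of
  \<open>f\<close> on \<open>S\<close>. The interpolant is \<open>f\<close> itself, since two
  polynomials of degree at most d that agree at d + 1 points coincide.\<close>

lemma lagrange_coeff:
  fixes f :: "'a :: field poly"
  assumes S: "finite S" "card S = Suc d" and f: "degree f \<le> d"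
  shows "coeff f d = (\<Sum>x\<in>S. poly f x / (\<Prod>y\<in>S - {x}. x - y))"
proof -
  \<comment> \<open>\<open>b x\<close> vanishes on \<open>S\<close> except at \<open>x\<close>, and
    \<open>c x\<close> rescales it to the value of \<open>f\<close> there.\<close>
  define b where "b x = (\<Prod>y\<in>S - {x}. [:- y, 1:])" for x
  define c where "c x = poly f x / (\<Prod>y\<in>S - {x}. x - y)" for x
  define g where "g = (\<Sum>x\<in>S. Polynomial.smult (c x) (b x))"
  have deg_b: "degree (b x) = d" if "x \<in> S" for x
    unfolding b_def using S that by (subst degree_prod_eq_sum_degree) auto
  have lead_b: "coeff (b x) d = 1" if "x \<in> S" for x
  proof -
    have "lead_coeff (b x) = 1" unfolding b_def by (simp add: lead_coeff_prod)
    then show ?thesis using deg_b[OF that] by simp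
  qed
  have poly_b: "poly (b x) z = (\<Prod>y\<in>S - {x}. z - y)" for x z
    unfolding b_def by (simp add: poly_prod)
  have "poly g z = poly f z" if z: "z \<in> S" for z
  proof -
    have "poly g z = (\<Sum>x\<in>S. c x * poly (b x) z)" by (simp add: g_def poly_sum)
    also have "\<dots> = (\<Sum>x\<in>{z}. c x * poly (b x) z)"
      using S z by (intro sum.mono_neutral_right) (auto simp: poly_b)
    also have "\<dots> = poly f z" using S by (auto simp: poly_b c_def)
    finally show ?thesis .
  qed
  moreover have "degree g \<le> d"
    unfolding g_def using S deg_b
    by (intro degree_sum_le) (auto intro: order.trans[OF degree_smult_le])
  ultimately have "g = f" using S f by (intro poly_eqI_degree[of S]) auto
  moreover have "coeff g d = (\<Sum>x\<in>S. c x)"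
    unfolding g_def using lead_b by (simp add: coeff_sum)
  ultimately show ?thesis by (simp add: c_def)
qed

text \<open>
  The moments determine the functional sending a polynomial f to the sum of w x * f x over S; the
  left-hand side says that on degree at most d it is a nonzero multiple of the d-th coefficient.
  From left to right, it is tested on monic polynomials of degree d vanishing on S, or on S without
  one point; from right to left, use Lagrange interpolation.
\<close>

lemma moments_vanish_iff:
  fixes w :: "'a :: field \<Rightarrow> 'a"
  assumes S: "finite S" "card S \<le> Suc d"
  shows "(\<forall>k<d. (\<Sum>x\<in>S. x ^ k * w x) = 0) \<and> (\<Sum>x\<in>S. x ^ d * w x) \<noteq> 0 \<longleftrightarrow>
    card S = Suc d \<and> (\<exists>c. c \<noteq> 0 \<and> (\<forall>x\<in>S. w x * (\<Prod>y\<in>S - {x}. x - y) = c))"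
    (is "?moments \<longleftrightarrow> ?weights")
proof
  assume mom: ?moments
  define c where "c = (\<Sum>x\<in>S. x ^ d * w x)"
  \<comment> \<open>Expand \<open>f\<close> in monomials: all moments below the d-th vanish, so only
    the top coefficient contributes.\<close>
  have eval: "(\<Sum>x\<in>S. w x * poly f x) = coeff f d * c" if f: "degree f \<le> d" for f
  proof -
    have "poly f x = (\<Sum>k\<le>d. coeff f k * x ^ k)" for x
      unfolding poly_altdef using f by (intro sum.mono_neutral_left) (auto simp: coeff_eq_0)
    then have "(\<Sum>x\<in>S. w x * poly f x) = (\<Sum>x\<in>S. \<Sum>k\<le>d. coeff f k * (x ^ k * w x))"
      by (simp add: sum_distrib_left mult_ac)
    also have "\<dots> = (\<Sum>k\<le>d. coeff f k * (\<Sum>x\<in>S. x ^ k * w x))"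
      by (subst sum.swap) (simp add: sum_distrib_left)
    also have "\<dots> = (\<Sum>k\<in>{d}. coeff f k * (\<Sum>x\<in>S. x ^ k * w x))"
      using mom by (intro sum.mono_neutral_right) auto
    finally show ?thesis by (simp add: c_def)
  qed
  have c: "c \<noteq> 0" using mom by (simp add: c_def)
  have monic_prod: "degree (\<Prod>y\<in>T. [:- y, 1:]) = card T \<and> lead_coeff (\<Prod>y\<in>T. [:- y, 1:]) = 1"
    for T :: "'a set"
    by (subst degree_prod_eq_sum_degree) (auto simp: lead_coeff_prod)
  have card: "card S = Suc d"
  proof (rule ccontr)
    assume "card S \<noteq> Suc d"
    then have le: "card S \<le> d" using S by simp
    \<comment> \<open>The monomial factor pads the degree to exactly d while \<open>f\<close> still
      vanishes on \<open>S\<close>, so \<open>eval\<close> would equate 0 with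
      \<open>c\<close>.\<close>
    define f where "f = monom 1 (d - card S) * (\<Prod>y\<in>S. [:- y, 1:])"
    have nz: "(\<Prod>y\<in>S. [:- y, 1:]) \<noteq> 0" using monic_prod[of S] by auto
    have "degree f = d" using nz monic_prod[of S] le
      by (simp add: f_def degree_mult_eq degree_monom_eq monom_eq_0_iff)
    moreover have "lead_coeff f = 1"
      unfolding f_def lead_coeff_mult monic_prod[THEN conjunct2] by (simp add: degree_monom_eq)
    moreover have "poly f x = 0" if "x \<in> S" for x
      using that S by (auto simp: f_def poly_prod prod_zero_iff)
    ultimately show False using eval[of f] c by simp
  qed
  have "w x * (\<Prod>y\<in>S - {x}. x - y) = c" if x: "x \<in> S" for x
  proof -
    \<comment> \<open>Among the points of \<open>S\<close> this monic polynomial of degree d can be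
      nonzero only at \<open>x\<close>, so \<open>eval\<close> isolates the weight at
      \<open>x\<close>.\<close>
    define f where "f = (\<Prod>y\<in>S - {x}. [:- y, 1:])"
    have deg: "degree f = d" "lead_coeff f = 1"
      using monic_prod[of "S - {x}"] S x card by (auto simp: f_def)
    have poly_f: "poly f z = (\<Prod>y\<in>S - {x}. z - y)" for z by (simp add: f_def poly_prod)
    have "(\<Sum>z\<in>S. w z * poly f z) = (\<Sum>z\<in>{x}. w z * poly f z)"
      using S x by (intro sum.mono_neutral_right) (auto simp: poly_f)
    then show ?thesis using eval[of f] deg by (simp add: poly_f)
  qed
  with card c show ?weights by blast
next
  assume ?weights
  then obtain c where card: "card S = Suc d" and c: "c \<noteq> 0"
    and w: "\<And>x. x \<in> S \<Longrightarrow> w x * (\<Prod>y\<in>S - {x}. x - y) = c" by blast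
  \<comment> \<open>The coefficient is 1 for k = d and 0 for smaller k, so this one formula covers
    all required moments.\<close>
  have "(\<Sum>x\<in>S. x ^ k * w x) = c * coeff (monom 1 k) d" if "k \<le> d" for k
  proof -
    have "x ^ k * w x = c * (poly (monom 1 k) x / (\<Prod>y\<in>S - {x}. x - y))" if "x \<in> S" for x
    proof -
      have "(\<Prod>y\<in>S - {x}. x - y) \<noteq> 0" using w[OF that] c by auto
      then show ?thesis using w[OF that] by (auto simp: poly_monom field_simps)
    qed
    then have "(\<Sum>x\<in>S. x ^ k * w x)
        = c * (\<Sum>x\<in>S. poly (monom 1 k) x / (\<Prod>y\<in>S - {x}. x - y))"
      by (simp add: sum_distrib_left)
    then show ?thesis
      using lagrange_coeff[OF S(1) card, of "monom 1 k"] that by (simp add: degree_monom_eq)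
  qed
  then show ?moments using c by simp
qed

section \<open>Diagonalizable matrices\<close>

lemma jordan_matrix_blocks_1_index:
  assumes "i < length as" "j < length as"
  shows "jordan_matrix (map (Pair 1) as) $$ (i, j) = (if i = j then as ! i else 0)"
  using assms
proof (induction as arbitrary: i j)
  case (Cons a as)
  then show ?case
    by (cases i; cases j) (auto simp: jordan_matrix_Cons sum_list_triv comp_def)
qed simp

text \<open>A diagonal matrix is a Jordan matrix with all blocks of size 1, and the kernel in
  question is a generalized eigenspace with exponent 1. In the dimension formula for Jordan matrices
  each block for \<theta> then counts once.\<close>

lemma kernel_dim_char_matrix_mat_diag:
  fixes f :: "nat \<Rightarrow> 'a :: field"
  shows "kernel_dim (char_matrix (mat_diag n f) \<theta>) = card {i. i < n \<and> f i = \<theta>}"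
proof -
  define as where "as = map f [0..<n]"
  have D: "mat_diag n f = jordan_matrix (map (Pair 1) as)"
  proof (rule eq_matI)
    fix i j
    assume "i < dim_row (jordan_matrix (map (Pair 1) as))" "j < dim_col (jordan_matrix (map (Pair 1) as))"
    then have ij: "i < n" "j < n" by (simp_all add: as_def comp_def sum_list_triv)
    then have "jordan_matrix (map (Pair 1) as) $$ (i, j) = (if i = j then as ! i else 0)"
      by (intro jordan_matrix_blocks_1_index) (simp_all add: as_def)
    then show "mat_diag n f $$ (i, j) = jordan_matrix (map (Pair 1) as) $$ (i, j)"
      using ij by (simp add: mat_diag_def as_def)
  qed (simp_all add: mat_diag_def as_def comp_def sum_list_triv)
  have "kernel_dim (char_matrix (mat_diag n f) \<theta>) = dim_gen_eigenspace (mat_diag n f) \<theta> 1"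
    by (simp add: dim_gen_eigenspace_def char_matrix_def)
  also have "\<dots> = length (filter (\<lambda>e. e = \<theta>) as)"
    unfolding D dim_gen_eigenspace_jordan_matrix
    by (induction as) auto
  also have "\<dots> = card {i. i < n \<and> f i = \<theta>}"
    by (auto simp: as_def length_filter_conv_card intro: arg_cong[of _ _ card])
  finally show ?thesis .
qed

lemma mat_diag_pow:
  "mat_diag n f ^\<^sub>m k = mat_diag n (\<lambda>i. f i ^ k)" for f :: "nat \<Rightarrow> 'a :: comm_semiring_1"
proof (induction k)
  case 0
  have "dim_row (mat_diag n f) = n" by (simp add: mat_diag_def)
  then show ?case by simp
qed (simp add: mult.commute)

lemma mat_diag_mult_vec:
  fixes v :: "'a :: semiring_1 vec"
  assumes "v \<in> carrier_vec n"
  shows "mat_diag n f *\<^sub>v v = vec n (\<lambda>i. f i * v $ i)"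
proof (rule eq_vecI)
  fix i assume i: "i < dim_vec (vec n (\<lambda>i. f i * v $ i))"
  then have "(mat_diag n f *\<^sub>v v) $ i = (\<Sum>j = 0..<n. (if i = j then f j else 0) * v $ j)"
    using assms by (simp add: mat_diag_def scalar_prod_def)
  also have "\<dots> = (\<Sum>j = 0..<n. if i = j then f j * v $ j else 0)"
    by (intro sum.cong) auto
  finally show "(mat_diag n f *\<^sub>v v) $ i = vec n (\<lambda>i. f i * v $ i) $ i"
    using i by simp
qed (simp add: mat_diag_def)

text \<open>The values of \<open>ev\<close> may repeat: multiplicity-freeness is to be characterized
  here, not assumed. The columns of \<open>P\<close> form a basis of eigenvectors, and
  \<open>Q\<close> gives the coordinates in it.\<close>

locale diagonalization =
  fixes A P Q :: "'a :: field mat" and n :: nat and ev :: "nat \<Rightarrow> 'a"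
  assumes A: "A \<in> carrier_mat n n"
    and wit: "similar_mat_wit A (mat_diag n ev) P Q"
begin

lemmas witD = similar_mat_witD2[OF A wit]

lemma PQ: "P * Q = 1\<^sub>m n" and QP: "Q * P = 1\<^sub>m n"
  and P [simp]: "P \<in> carrier_mat n n" and Q [simp]: "Q \<in> carrier_mat n n"
  using witD by auto

lemma dim_PQ [simp]: "dim_row P = n" "dim_col P = n" "dim_row Q = n" "dim_col Q = n"
  using carrier_matD[OF P] carrier_matD[OF Q] by auto

text \<open>This is the functional calculus f(A). It treats powers of \<open>A\<close> and primitive
  idempotents alike: the latter arise from indicator functions of single eigenvalues.\<close>

definition spectral_mat :: "('a \<Rightarrow> 'a) \<Rightarrow> 'a mat" where
  "spectral_mat f = P * mat_diag n (\<lambda>r. f (ev r)) * Q"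

lemma spectral_mat_carrier [simp]: "spectral_mat f \<in> carrier_mat n n"
  unfolding spectral_mat_def by (intro mult_carrier_mat[of _ n n]) auto

lemma spectral_mat_index:
  assumes "i < n" "j < n"
  shows "spectral_mat f $$ (i, j) = (\<Sum>r<n. P $$ (i, r) * f (ev r) * Q $$ (r, j))"
proof -
  have "P * mat_diag n (\<lambda>r. f (ev r)) = mat n n (\<lambda>(i, j). P $$ (i, j) * f (ev j))"
    by (rule mat_diag_mult_right) simp
  then show ?thesis
    using assms unfolding spectral_mat_def
    by (auto simp: scalar_prod_def lessThan_atLeast0 intro!: sum.cong)
qed

lemma pow_eq_spectral_mat: "A ^\<^sub>m k = spectral_mat (\<lambda>x. x ^ k)"
  unfolding spectral_mat_def similar_mat_wit_pow_id[OF wit] mat_diag_pow ..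

text \<open>Similar matrices share the characteristic polynomial, which for a diagonal matrix splits
  into linear factors with the diagonal entries as roots.\<close>

lemma spectrum_eq: "spectrum A = ev ` {..<n}"
proof -
  have "char_poly A = char_poly (mat_diag n ev)"
    using wit by (intro char_poly_similar) (auto simp: similar_mat_def)
  also have "\<dots> = (\<Prod>a\<leftarrow>diag_mat (mat_diag n ev). [:- a, 1:])"
    by (rule char_poly_upper_triangular[of _ n]) (auto simp: mat_diag_def)
  also have "diag_mat (mat_diag n ev) = map ev [0..<n]"
    by (auto simp: diag_mat_def mat_diag_def)
  finally have "poly (char_poly A) k = 0 \<longleftrightarrow> k \<in> ev ` {..<n}" for k
    by (auto simp: poly_prod_list prod_list_zero_iff)
  then show ?thesis
    unfolding spectrum_def eigenvalue_root_char_poly[OF A] by auto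
qed

lemma finite_spectrum: "finite (spectrum A)" and card_spectrum_le: "card (spectrum A) \<le> n"
  unfolding spectrum_eq using card_image_le[of "{..<n}" ev] by auto

lemma kernel_dim_char_matrix: "kernel_dim (char_matrix A \<theta>) = card {r. r < n \<and> ev r = \<theta>}"
proof -
  have "similar_mat A (mat_diag n ev)" using wit by (auto simp: similar_mat_def)
  from dim_gen_eigenspace_similar[OF this]
  have "dim_gen_eigenspace A \<theta> 1 = dim_gen_eigenspace (mat_diag n ev) \<theta> 1" by simp
  then show ?thesis
    using A kernel_dim_char_matrix_mat_diag[of n ev \<theta>]
    by (simp add: dim_gen_eigenspace_def char_matrix_def)
qed

lemma diagonalizable: "diagonalizable A"
  unfolding diagonalizable_def similar_mat_def
  using wit by (intro exI[of _ "mat_diag n ev"] conjI exI[of _ P] exI[of _ Q])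
    (auto simp: diagonal_mat_def mat_diag_def)

text \<open>The eigenspace dimensions are the sizes of the fibres of \<open>ev\<close>. They are all
  1 iff \<open>ev\<close> is injective on the n indices, that is, iff its image has n
  elements.\<close>

lemma multiplicity_free_iff: "multiplicity_free A \<longleftrightarrow> card (spectrum A) = n"
proof -
  have "multiplicity_free A \<longleftrightarrow> (\<forall>\<theta>\<in>ev ` {..<n}. card {r. r < n \<and> ev r = \<theta>} = 1)"
    using diagonalizable unfolding spectrum_eq[symmetric]
    by (simp add: multiplicity_free_def kernel_dim_char_matrix spectrum_def)
  also have "\<dots> \<longleftrightarrow> inj_on ev {..<n}"
  proof
    assume *: "\<forall>\<theta>\<in>ev ` {..<n}. card {r. r < n \<and> ev r = \<theta>} = 1"
    show "inj_on ev {..<n}"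
    proof (rule inj_onI)
      fix i j assume ij: "i \<in> {..<n}" "j \<in> {..<n}" "ev i = ev j"
      with * have "card {r. r < n \<and> ev r = ev i} = 1" by blast
      then obtain u where "{r. r < n \<and> ev r = ev i} = {u}" by (rule card_1_singletonE)
      moreover have "i \<in> {r. r < n \<and> ev r = ev i}" "j \<in> {r. r < n \<and> ev r = ev i}"
        using ij by simp_all
      ultimately show "i = j" by (metis singletonD)
    qed
  next
    assume inj: "inj_on ev {..<n}"
    have "{r. r < n \<and> ev r = ev i} = {i}" if "i < n" for i
      using inj_onD[OF inj] that by auto
    then show "\<forall>\<theta>\<in>ev ` {..<n}. card {r. r < n \<and> ev r = \<theta>} = 1" by auto
  qed
  also have "\<dots> \<longleftrightarrow> card (spectrum A) = n"
    unfolding spectrum_eq by (simp add: inj_on_iff_eq_card)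
  finally show ?thesis .
qed

text \<open>In the coordinates \<open>Q *\<^sub>v v\<close>, the matrix
  \<open>char_matrix A \<theta>\<close> multiplies the r-th entry by \<open>ev r - \<theta>\<close>,
  so its kernel leaves free only the entries where this factor is 0.\<close>

lemma eigenspace_iff:
  "v \<in> eigenspace A \<theta> \<longleftrightarrow>
    v \<in> carrier_vec n \<and> (\<forall>r<n. ev r \<noteq> \<theta> \<longrightarrow> (Q *\<^sub>v v) $ r = 0)"
proof (cases "v \<in> carrier_vec n")
  case v: True
  let ?D = "char_matrix (mat_diag n ev) \<theta>"
  have C: "char_matrix A \<theta> \<in> carrier_mat n n" using A by simp
  note w = similar_mat_witD2[OF C similar_mat_wit_char_matrix[OF wit]]
  have D: "?D = mat_diag n (\<lambda>r. ev r - \<theta>)"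
    by (rule eq_matI) (auto simp: char_matrix_def mat_diag_def)
  have Qv: "Q *\<^sub>v v \<in> carrier_vec n" using mult_mat_vec_carrier[OF Q v] .
  have DQv: "?D *\<^sub>v (Q *\<^sub>v v) = vec n (\<lambda>r. (ev r - \<theta>) * (Q *\<^sub>v v) $ r)"
    unfolding D by (rule mat_diag_mult_vec[OF Qv])
  have Cv: "char_matrix A \<theta> *\<^sub>v v = P *\<^sub>v (?D *\<^sub>v (Q *\<^sub>v v))"
    unfolding w(3)
    using assoc_mult_mat_vec[OF mult_carrier_mat[OF P w(5)] Q v] assoc_mult_mat_vec[OF P w(5) Qv]
    by simp
  \<comment> \<open>The outer factor \<open>P\<close> cancels because \<open>Q\<close> is its
    inverse.\<close>
  have "char_matrix A \<theta> *\<^sub>v v = 0\<^sub>v n \<longleftrightarrow> ?D *\<^sub>v (Q *\<^sub>v v) = 0\<^sub>v n"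
  proof
    assume "char_matrix A \<theta> *\<^sub>v v = 0\<^sub>v n"
    then have "Q *\<^sub>v (P *\<^sub>v (?D *\<^sub>v (Q *\<^sub>v v))) = Q *\<^sub>v 0\<^sub>v n" using Cv by simp
    moreover have DQc: "?D *\<^sub>v (Q *\<^sub>v v) \<in> carrier_vec n" unfolding DQv by simp
    ultimately show "?D *\<^sub>v (Q *\<^sub>v v) = 0\<^sub>v n"
      using assoc_mult_mat_vec[OF Q P DQc] QP Q by auto
  next
    assume "?D *\<^sub>v (Q *\<^sub>v v) = 0\<^sub>v n"
    then show "char_matrix A \<theta> *\<^sub>v v = 0\<^sub>v n" using Cv P by auto
  qed
  also have "\<dots> \<longleftrightarrow> (\<forall>r<n. ev r \<noteq> \<theta> \<longrightarrow> (Q *\<^sub>v v) $ r = 0)"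
    unfolding DQv by (auto simp: vec_eq_iff)
  finally show ?thesis using v unfolding eigenspace_def mat_kernel[OF C] by simp
next
  case False
  then show ?thesis using A unfolding eigenspace_def by (auto simp: mat_kernel[of _ n n])
qed

text \<open>The r-th coordinate is scaled by \<open>f (ev r)\<close>, and a vector of this
  eigenspace has nonzero coordinates only where \<open>ev r = \<mu>\<close>.\<close>

lemma spectral_mat_mult_vec:
  assumes v: "v \<in> eigenspace A \<mu>"
  shows "spectral_mat f *\<^sub>v v = f \<mu> \<cdot>\<^sub>v v"
proof -
  have vc: "v \<in> carrier_vec n" and z: "\<And>r. r < n \<Longrightarrow> ev r \<noteq> \<mu> \<Longrightarrow> (Q *\<^sub>v v) $ r = 0"
    using v eigenspace_iff by auto
  have Qv: "Q *\<^sub>v v \<in> carrier_vec n" using mult_mat_vec_carrier[OF Q vc] .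
  have D: "mat_diag n (\<lambda>r. f (ev r)) \<in> carrier_mat n n" by simp
  have "mat_diag n (\<lambda>r. f (ev r)) *\<^sub>v (Q *\<^sub>v v) = vec n (\<lambda>r. f (ev r) * (Q *\<^sub>v v) $ r)"
    by (rule mat_diag_mult_vec[OF Qv])
  also have "\<dots> = f \<mu> \<cdot>\<^sub>v (Q *\<^sub>v v)"
  proof (rule eq_vecI)
    show "vec n (\<lambda>r. f (ev r) * (Q *\<^sub>v v) $ r) $ r = (f \<mu> \<cdot>\<^sub>v (Q *\<^sub>v v)) $ r"
      if "r < dim_vec (f \<mu> \<cdot>\<^sub>v (Q *\<^sub>v v))" for r
      using that z[of r] by (cases "ev r = \<mu>") (auto simp del: index_mult_mat_vec)
  qed simp
  finally have "spectral_mat f *\<^sub>v v = P *\<^sub>v (f \<mu> \<cdot>\<^sub>v (Q *\<^sub>v v))"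
    unfolding spectral_mat_def
    using assoc_mult_mat_vec[OF mult_carrier_mat[OF P D] Q vc] assoc_mult_mat_vec[OF P D Qv] by simp
  also have "\<dots> = f \<mu> \<cdot>\<^sub>v (P *\<^sub>v (Q *\<^sub>v v))" using mult_mat_vec[OF P Qv] .
  also have "P *\<^sub>v (Q *\<^sub>v v) = v"
    using assoc_mult_mat_vec[OF P Q vc] PQ vc by simp
  finally show ?thesis .
qed

lemma col_P_in_eigenspace:
  assumes "r < n"
  shows "col P r \<in> eigenspace A (ev r)"
proof -
  have "Q *\<^sub>v col P r = col (Q * P) r" using assms by (simp add: col_mult2[OF Q P])
  then have "Q *\<^sub>v col P r = unit_vec n r" using assms by (simp add: QP)
  then show ?thesis using assms P by (auto simp: eigenspace_iff)
qed

text \<open>The defining conditions fix the action of \<open>E\<close> on every eigenvector, hence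
  on the columns of \<open>P\<close>, which form a basis. Conversely, the indicator function acts by
  1 on the eigenspace for \<theta> and by 0 on the others.\<close>

lemma primitive_idempotent_iff:
  assumes \<theta>: "\<theta> \<in> spectrum A"
  shows "primitive_idempotent A \<theta> E \<longleftrightarrow> E = spectral_mat (\<lambda>x. if x = \<theta> then 1 else 0)"
    (is "_ \<longleftrightarrow> E = ?S")
proof
  have minus_zero: "(E - 1\<^sub>m n) *\<^sub>v v = 0\<^sub>v n \<longleftrightarrow> E *\<^sub>v v = v"
    if "E \<in> carrier_mat n n" "v \<in> carrier_vec n" for E :: "'a mat" and v
    using that by (auto simp: minus_mult_distrib_mat_vec[of _ n n] vec_eq_iff)
  have in_carrier: "v \<in> carrier_vec n" if "v \<in> eigenspace A \<mu>" for v \<mu>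
    using that eigenspace_iff by simp
  {
    assume "primitive_idempotent A \<theta> E"
    then have E: "E \<in> carrier_mat n n"
      and E1: "\<And>v. v \<in> eigenspace A \<theta> \<Longrightarrow> (E - 1\<^sub>m n) *\<^sub>v v = 0\<^sub>v n"
      and E0: "\<And>\<mu> v. \<mu> \<in> spectrum A \<Longrightarrow> \<mu> \<noteq> \<theta> \<Longrightarrow> v \<in> eigenspace A \<mu> \<Longrightarrow> E *\<^sub>v v = 0\<^sub>v n"
      using A by (auto simp: primitive_idempotent_def)
    have "E * P = ?S * P"
    proof (rule mat_col_eqI)
      fix r assume "r < dim_col (?S * P)"
      then have r: "r < n" using P by simp
      note v = col_P_in_eigenspace[OF r]
      have "E *\<^sub>v col P r = ?S *\<^sub>v col P r"
      proof (cases "ev r = \<theta>")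
        case True
        then have "E *\<^sub>v col P r = col P r" using E1 minus_zero E in_carrier v by metis
        then show ?thesis using spectral_mat_mult_vec[OF v] True by simp
      next
        case False
        then have "E *\<^sub>v col P r = 0\<^sub>v n" using E0[OF _ False v] r spectrum_eq by auto
        moreover have "0 \<cdot>\<^sub>v col P r = 0\<^sub>v n"
          using r by (intro eq_vecI) auto
        ultimately show ?thesis using spectral_mat_mult_vec[OF v] False by simp
      qed
      then show "col (E * P) r = col (?S * P) r"
        using r by (simp only: col_mult2[OF E P] col_mult2[OF spectral_mat_carrier P])
    qed (use E in \<open>auto simp: carrier_matD[OF spectral_mat_carrier]\<close>)
    \<comment> \<open>Agreement on the eigenvector basis extends to all vectors by cancelling
      \<open>P\<close> with its inverse \<open>Q\<close>.\<close>
    then have "(E * P) * Q = (?S * P) * Q" by simp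
    then show "E = ?S"
      using assoc_mult_mat[OF E P Q] assoc_mult_mat[OF spectral_mat_carrier P Q] PQ E
      by (metis right_mult_one_mat spectral_mat_carrier)
  next
    assume E: "E = ?S"
    have "?S *\<^sub>v v = v" if "v \<in> eigenspace A \<theta>" for v
      using spectral_mat_mult_vec[OF that, of "\<lambda>x. if x = \<theta> then 1 else 0"] by simp
    moreover have "?S *\<^sub>v v = 0\<^sub>v n" if "v \<in> eigenspace A \<mu>" "\<mu> \<noteq> \<theta>" for v \<mu>
      using spectral_mat_mult_vec[OF that(1), of "\<lambda>x. if x = \<theta> then 1 else 0"] that
        in_carrier[OF that(1)] by (simp, intro eq_vecI) auto
    moreover have "dim_row A = n" using A by simp
    ultimately show "primitive_idempotent A \<theta> E"
      unfolding primitive_idempotent_def E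
      using minus_zero[OF spectral_mat_carrier in_carrier] by simp
  }
qed

text \<open>This is the spectral decomposition of the power, read off at one entry: the terms of the
  diagonalized form are grouped by eigenvalue, each index r belonging to exactly one group.\<close>

lemma pow_index_eq_moment:
  assumes "i < n" "j < n"
  shows "(A ^\<^sub>m k) $$ (i, j) =
    (\<Sum>x\<in>spectrum A. x ^ k * spectral_mat (\<lambda>y. if y = x then 1 else 0) $$ (i, j))"
proof -
  have "(\<Sum>x\<in>spectrum A. x ^ k * spectral_mat (\<lambda>y. if y = x then 1 else 0) $$ (i, j))
      = (\<Sum>x\<in>spectrum A. \<Sum>r<n. if x = ev r then P $$ (i, r) * x ^ k * Q $$ (r, j) else 0)"
    by (auto simp: spectral_mat_index assms sum_distrib_left intro!: sum.cong)
  also have "\<dots> = (\<Sum>r<n. P $$ (i, r) * ev r ^ k * Q $$ (r, j))"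
    using finite_spectrum by (subst sum.swap) (auto simp: spectrum_eq intro!: sum.cong)
  finally show ?thesis by (simp add: pow_eq_spectral_mat spectral_mat_index assms)
qed

end

section \<open>Orderings of the eigenvalues and the equivalence\<close>

lemma diagonalizableE:
  assumes "diagonalizable A" and A: "A \<in> carrier_mat n n"
  obtains P Q ev where "diagonalization A P Q n ev"
proof -
  obtain D P Q where D: "diagonal_mat D" and wit: "similar_mat_wit A D P Q"
    using assms by (auto simp: diagonalizable_def similar_mat_def)
  have "D \<in> carrier_mat n n" using similar_mat_witD2[OF A wit] by simp
  with D have "D = mat_diag n (\<lambda>r. D $$ (r, r))"
    by (intro eq_matI) (auto simp: mat_diag_def diagonal_mat_def)
  with wit A have "diagonalization A P Q n (\<lambda>r. D $$ (r, r))"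
    by unfold_locales simp_all
  then show ?thesis by (rule that)
qed

text \<open>Turns the product over indices into one over eigenvalues, where the chosen ordering no
  longer matters.\<close>

lemma prod_diff_reindex:
  fixes \<theta> :: "'b \<Rightarrow> 'a :: comm_ring_1"
  assumes "bij_betw \<theta> I S" "i \<in> I"
  shows "(\<Prod>j\<in>I - {i}. \<theta> i - \<theta> j) = (\<Prod>y\<in>S - {\<theta> i}. \<theta> i - y)"
proof -
  have "bij_betw \<theta> (I - {i}) (S - {\<theta> i})"
    using bij_betw_DiffI[OF assms(1), of "{i}" "{\<theta> i}"] assms(2) bij_betwE[OF assms(1)]
    by (auto simp: bij_betw_def)
  from prod.reindex_bij_betw[OF this, of "\<lambda>y. \<theta> i - y"] show ?thesis .
qed

theorem theorem1p4:
  fixes d s t :: nat and A :: "real mat"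
  assumes "A \<in> carrier_mat (d + 1) (d + 1)"
    and "\<forall>i \<le> d. \<forall>j \<le> d. A $$ (i, j) \<ge> 0"
    and "s \<le> d" and "t \<le> d"
  shows "diagonalizable A \<and> directed_distance (with_proj (matrix_digraph A)) s t d \<longleftrightarrow>
    multiplicity_free A \<and>
    (\<forall>\<theta> E. eigenvalue_ordering A d \<theta> \<and> (\<forall>i \<le> d. primitive_idempotent A (\<theta> i) (E i)) \<longrightarrow>
      (\<exists>c. c \<noteq> 0 \<and>
        (\<forall>i \<le> d. E i $$ (s, t) * (\<Prod>j \<in> {0..d} - {i}. \<theta> i - \<theta> j) = c)))"
proof (cases "diagonalizable A")
  \<comment> \<open>Both sides fail, as multiplicity-freeness includes diagonalizability.\<close>
  case False
  then show ?thesis by (simp add: multiplicity_free_def)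
next
  case True
  then obtain P Q ev where "diagonalization A P Q (d + 1) ev"
    using diagonalizableE assms(1) by blast
  then interpret diagonalization A P Q "d + 1" ev .
  define w where "w x = spectral_mat (\<lambda>y. if y = x then 1 else 0) $$ (s, t)" for x
  let ?S = "spectrum A"
  let ?weights = "\<exists>c. c \<noteq> 0 \<and> (\<forall>x\<in>?S. w x * (\<Prod>y\<in>?S - {x}. x - y) = c)"
  have ordering: "(\<exists>c. c \<noteq> 0 \<and>
        (\<forall>i \<le> d. E i $$ (s, t) * (\<Prod>j \<in> {0..d} - {i}. \<theta> i - \<theta> j) = c)) \<longleftrightarrow> ?weights"
    if ord: "eigenvalue_ordering A d \<theta>" and E: "\<forall>i \<le> d. primitive_idempotent A (\<theta> i) (E i)"
    for \<theta> E
  proof -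
    have bij: "bij_betw \<theta> {0..d} ?S" using ord by (simp add: eigenvalue_ordering_def)
    have "E i $$ (s, t) * (\<Prod>j \<in> {0..d} - {i}. \<theta> i - \<theta> j)
        = w (\<theta> i) * (\<Prod>y\<in>?S - {\<theta> i}. \<theta> i - y)" if "i \<le> d" for i
      using primitive_idempotent_iff[of "\<theta> i" "E i"] E that bij_betwE[OF bij]
        prod_diff_reindex[OF bij, of i] by (simp add: w_def)
    moreover have "?S = \<theta> ` {0..d}" using bij by (simp add: bij_betw_def)
    ultimately show ?thesis by auto
  qed
  \<comment> \<open>Without some ordering and its idempotents, the universal statement in (ii) would
    hold vacuously and say nothing about the weights.\<close>
  have exists: "\<exists>\<theta> E. eigenvalue_ordering A d \<theta> \<and> (\<forall>i \<le> d. primitive_idempotent A (\<theta> i) (E i))"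
    if "card ?S = d + 1"
  proof -
    obtain \<theta> where bij: "bij_betw \<theta> {0..<card ?S} ?S"
      using ex_bij_betw_nat_finite[OF finite_spectrum] by blast
    moreover have "{0..<card ?S} = {0..d}" using that by auto
    ultimately have bij: "bij_betw \<theta> {0..d} ?S" by simp
    then have "\<forall>i \<le> d. \<theta> i \<in> ?S" using bij_betwE by fastforce
    then show ?thesis
      using bij primitive_idempotent_iff unfolding eigenvalue_ordering_def
      by (intro exI[of _ \<theta>] exI[of _ "\<lambda>i. spectral_mat (\<lambda>y. if y = \<theta> i then 1 else 0)"]) auto
  qed
  have all_orderings: "(\<forall>\<theta> E. eigenvalue_ordering A d \<theta> \<and>
        (\<forall>i \<le> d. primitive_idempotent A (\<theta> i) (E i)) \<longrightarrow>
      (\<exists>c. c \<noteq> 0 \<and>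
        (\<forall>i \<le> d. E i $$ (s, t) * (\<Prod>j \<in> {0..d} - {i}. \<theta> i - \<theta> j) = c))) \<longleftrightarrow> ?weights"
    (is "?all \<longleftrightarrow> _") if card: "card ?S = d + 1"
  proof
    assume all: ?all
    from exists[OF card] obtain \<theta> E where "eigenvalue_ordering A d \<theta>"
      and "\<forall>i \<le> d. primitive_idempotent A (\<theta> i) (E i)" by blast
    from ordering[OF this] all this show ?weights by blast
  next
    assume ?weights
    show ?all
    proof (intro allI impI, elim conjE)
      fix \<theta> E
      assume "eigenvalue_ordering A d \<theta>" "\<forall>i \<le> d. primitive_idempotent A (\<theta> i) (E i)"
      from ordering[OF this] \<open>?weights\<close> show "\<exists>c. c \<noteq> 0 \<and>
        (\<forall>i \<le> d. E i $$ (s, t) * (\<Prod>j \<in> {0..d} - {i}. \<theta> i - \<theta> j) = c)" by (rule iffD2)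
    qed
  qed
  have "directed_distance (with_proj (matrix_digraph A)) s t d \<longleftrightarrow>
      (\<forall>k<d. (A ^\<^sub>m k) $$ (s, t) = 0) \<and> (A ^\<^sub>m d) $$ (s, t) \<noteq> 0"
    using assms by (intro directed_distance_iff_pow_mat[OF assms(1)]) auto
  \<comment> \<open>The entries of the powers are the moments of \<open>w\<close> on the spectrum,
    which has at most d + 1 points.\<close>
  also have "\<dots> \<longleftrightarrow> card ?S = Suc d \<and> ?weights"
    using assms(3,4) pow_index_eq_moment[of s t]
      moments_vanish_iff[OF finite_spectrum, of d w] card_spectrum_le
    by (simp add: w_def)
  finally have dist: "directed_distance (with_proj (matrix_digraph A)) s t d \<longleftrightarrow>
      card ?S = d + 1 \<and> ?weights" by simp
  show ?thesis
    unfolding dist multiplicity_free_iff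
    \<comment> \<open>\<open>all_orderings\<close> presupposes d + 1 distinct eigenvalues; the
      congruence rule supplies this from the first conjunct.\<close>
    using True by (simp add: all_orderings cong: conj_cong)
qed

end
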